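(* Let $n=q_1q_2\cdots q_t$ be the factorization of an integer $n\ge 2$ as a product of powers of distinct primes, and let $q=\min\{q_i: i=1,\dots,t\}$. Then there exists a $(q-2)$-IPC$(n,n-1)$.
   Context: For permutations $\sigma,\tau$ of $[n]=\{1,\dots,n\}$, the Hamming distance is the number of $x$ with $\sigma(x)\neq\tau(x)$. A permutation code PC$(n,d)$ is a subset of $\mathcal{S}_n$ in which any two distinct elements are at Hamming distance at least $d$. A permutation code is idempotent if each of its words has exactly one fixed point. An $r$-IPC$(n,n-1)$ is an idempotent PC$(n,n-1)$ on $[n]$ in which every symbol $i\in[n]$ is the fixed point of exactly $r$ words. *)

theory Defs
  imports Complex_Main "HOL-Combinatorics.Permutations" "HOL-Computational_Algebra.Primes"
begin

text \<open>
  Permutations of $[n]$ are functions on \<^typ>\<open>nat\<close> that permute \<open>{1..n}\<close> and are the identity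
  outside it. Hence distances and fixed points are counted over \<open>{1..n}\<close> only.
\<close>

definition hamming_dist :: "nat \<Rightarrow> (nat \<Rightarrow> nat) \<Rightarrow> (nat \<Rightarrow> nat) \<Rightarrow> nat" where
  "hamming_dist n \<sigma> \<tau> = card {x \<in> {1..n}. \<sigma> x \<noteq> \<tau> x}"

definition permutation_code :: "nat \<Rightarrow> nat \<Rightarrow> (nat \<Rightarrow> nat) set \<Rightarrow> bool" where
  "permutation_code n d C \<longleftrightarrow>
     C \<subseteq> {\<sigma>. \<sigma> permutes {1..n}} \<and>
     (\<forall>\<sigma>\<in>C. \<forall>\<tau>\<in>C. \<sigma> \<noteq> \<tau> \<longrightarrow> d \<le> hamming_dist n \<sigma> \<tau>)"

definition idempotent_code :: "nat \<Rightarrow> (nat \<Rightarrow> nat) set \<Rightarrow> bool" where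
  "idempotent_code n C \<longleftrightarrow> (\<forall>\<sigma>\<in>C. \<exists>!x. x \<in> {1..n} \<and> \<sigma> x = x)"

definition r_IPC :: "nat \<Rightarrow> nat \<Rightarrow> (nat \<Rightarrow> nat) set \<Rightarrow> bool" where
  "r_IPC r n C \<longleftrightarrow>
     permutation_code n (n - 1) C \<and> idempotent_code n C \<and>
     (\<forall>i\<in>{1..n}. card {\<sigma> \<in> C. \<sigma> i = i} = r)"

end

theory Submission
  imports Defs "HOL-Computational_Algebra.Polynomial"
begin

text \<open>
  Over a field with \<open>q\<close> elements, the maps \<open>x \<mapsto> c (x - b) + b\<close> with \<open>c\<close> different from 0 and 1
  have \<open>b\<close> as their only fixed point; two of them with the same \<open>c\<close> never agree, and two with
  different \<open>c\<close> agree in exactly one point. These are the rows of \<open>q - 2\<close> idempotent mutually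
  orthogonal Latin squares of order \<open>q\<close>. Such systems multiply, and the rows of a system
  of order \<open>n\<close> form the required code.

  The field is \<open>\<int>[\<zeta>] / P\<close>, where \<open>\<zeta>\<close> is a primitive complex root of unity of order \<open>q - 1\<close> and
  \<open>P\<close> is a prime ideal above the prime dividing \<open>q\<close>. By Frobenius every residue class satisfies
  \<open>x ^ q = x\<close>, so it is 0 or a power of \<open>\<zeta>\<close>.
\<close>

section \<open>Idempotent mutually orthogonal Latin squares\<close>

text \<open>\<open>f j b x\<close> is the entry of square \<open>j\<close> in row \<open>b\<close>
  and column \<open>x\<close>. The last clause lets rows of different squares agree in at most one
  column. For finite \<open>A\<close> this is ordinary orthogonality once row index and symbol are
  exchanged in every square, and it is the form that Hamming distance needs.\<close>

definition idem_MOLS :: "'a set \<Rightarrow> nat \<Rightarrow> (nat \<Rightarrow> 'a \<Rightarrow> 'a \<Rightarrow> 'a) \<Rightarrow> bool" where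
  "idem_MOLS A k f \<longleftrightarrow>
     (\<forall>j<k. \<forall>b\<in>A. \<forall>x\<in>A. f j b x \<in> A) \<and>
     (\<forall>j<k. \<forall>b\<in>A. f j b b = b) \<and>
     (\<forall>j<k. \<forall>b\<in>A. \<forall>x\<in>A. \<forall>y\<in>A. f j b x = f j b y \<longrightarrow> x = y) \<and>
     (\<forall>j<k. \<forall>b\<in>A. \<forall>c\<in>A. \<forall>x\<in>A. f j b x = f j c x \<longrightarrow> b = c) \<and>
     (\<forall>i<k. \<forall>j<k. \<forall>b\<in>A. \<forall>c\<in>A. \<forall>x\<in>A. \<forall>y\<in>A.
        i \<noteq> j \<longrightarrow> f i b x = f j c x \<longrightarrow> f i b y = f j c y \<longrightarrow> x = y)"

lemma
  assumes "idem_MOLS A k f"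
  shows idem_MOLS_closed: "\<lbrakk>j < k; b \<in> A; x \<in> A\<rbrakk> \<Longrightarrow> f j b x \<in> A"
    and idem_MOLS_idem: "\<lbrakk>j < k; b \<in> A\<rbrakk> \<Longrightarrow> f j b b = b"
    and idem_MOLS_row: "\<lbrakk>f j b x = f j b y; j < k; b \<in> A; x \<in> A; y \<in> A\<rbrakk> \<Longrightarrow> x = y"
    and idem_MOLS_col: "\<lbrakk>f j b x = f j c x; j < k; b \<in> A; c \<in> A; x \<in> A\<rbrakk> \<Longrightarrow> b = c"
    and idem_MOLS_orth: "\<lbrakk>f i b x = f j c x; f i b y = f j c y; i \<noteq> j; i < k; j < k;
      b \<in> A; c \<in> A; x \<in> A; y \<in> A\<rbrakk> \<Longrightarrow> x = y"
proof -
  note D = assms[unfolded idem_MOLS_def]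
  show "f j b x \<in> A" if "j < k" "b \<in> A" "x \<in> A"
    by (rule D[THEN conjunct1, rule_format]) fact+
  show "f j b b = b" if "j < k" "b \<in> A"
    by (rule D[THEN conjunct2, THEN conjunct1, rule_format]) fact+
  show "x = y" if "f j b x = f j b y" "j < k" "b \<in> A" "x \<in> A" "y \<in> A"
    by (rule D[THEN conjunct2, THEN conjunct2, THEN conjunct1, rule_format, of j b]) fact+
  show "b = c" if "f j b x = f j c x" "j < k" "b \<in> A" "c \<in> A" "x \<in> A"
    by (rule D[THEN conjunct2, THEN conjunct2, THEN conjunct2, THEN conjunct1, rule_format, of j b c x]) fact+
  show "x = y" if "f i b x = f j c x" "f i b y = f j c y" "i \<noteq> j" "i < k" "j < k"
      "b \<in> A" "c \<in> A" "x \<in> A" "y \<in> A"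
    by (rule D[THEN conjunct2, THEN conjunct2, THEN conjunct2, THEN conjunct2, rule_format, of i j b c]) fact+
qed

lemma idem_MOLS_mono:
  assumes f: "idem_MOLS A k f" and l: "l \<le> k"
  shows "idem_MOLS A l f"
proof -
  have k: "j < k" if "j < l" for j using that l by simp
  show ?thesis
    unfolding idem_MOLS_def
    by (intro conjI allI ballI impI)
      (erule (1) idem_MOLS_closed[OF f k] idem_MOLS_idem[OF f k] idem_MOLS_row[OF f _ k]
        idem_MOLS_col[OF f _ k] idem_MOLS_orth[OF f _ _ _ k k]; assumption)+
qed

lemma idem_MOLS_transfer:
  assumes h: "bij_betw h A B" and f: "idem_MOLS A k f"
  shows "\<exists>g. idem_MOLS B k g"
proof -
  define u where "u = inv_into A h"
  have u: "u b \<in> A" "h (u b) = b" if "b \<in> B" for b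
    using that h unfolding u_def bij_betw_def
    by (auto intro: inv_into_into f_inv_into_f)
  have hB: "h a \<in> B" if "a \<in> A" for a using that h by (auto simp: bij_betw_def)
  have inj: "h a = h b \<longleftrightarrow> a = b" if "a \<in> A" "b \<in> A" for a b
    using that h by (auto simp: bij_betw_def inj_on_def)
  have uinj: "b = c" if "u b = u c" "b \<in> B" "c \<in> B" for b c using that u by metis
  note closed = idem_MOLS_closed[OF f]
  have eq: "f i (u b) (u x) = f j (u c) (u y)"
    if "h (f i (u b) (u x)) = h (f j (u c) (u y))" "i < k" "j < k"
      "b \<in> B" "c \<in> B" "x \<in> B" "y \<in> B" for i j b c x y
    using that inj closed u(1) by simp
  have "idem_MOLS B k (\<lambda>j b x. h (f j (u b) (u x)))"
    unfolding idem_MOLS_def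
  proof (intro conjI allI ballI impI)
    fix j b x assume "j < k" "b \<in> B" "x \<in> B"
    then show "h (f j (u b) (u x)) \<in> B" using closed u(1) hB by simp
  next
    fix j b assume "j < k" "b \<in> B"
    then show "h (f j (u b) (u b)) = b" using idem_MOLS_idem[OF f] u by simp
  next
    fix j b x y assume *: "j < k" "b \<in> B" "x \<in> B" "y \<in> B" "h (f j (u b) (u x)) = h (f j (u b) (u y))"
    show "x = y"
      by (rule uinj, rule idem_MOLS_row[OF f], rule eq) (use * u in auto)
  next
    fix j b c x assume *: "j < k" "b \<in> B" "c \<in> B" "x \<in> B" "h (f j (u b) (u x)) = h (f j (u c) (u x))"
    show "b = c"
      by (rule uinj, rule idem_MOLS_col[OF f], rule eq, rule *(5)) (use * u in auto)
  next
    fix i j b c x y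
    assume *: "i < k" "j < k" "b \<in> B" "c \<in> B" "x \<in> B" "y \<in> B" "i \<noteq> j"
      "h (f i (u b) (u x)) = h (f j (u c) (u x))" "h (f i (u b) (u y)) = h (f j (u c) (u y))"
    have "f i (u b) (u x) = f j (u c) (u x)" "f i (u b) (u y) = f j (u c) (u y)"
      using * by (auto intro: eq)
    from idem_MOLS_orth[OF f this] show "x = y" using * u(1) by (auto intro: uinj)
  qed
  then show ?thesis by blast
qed

text \<open>MacNeish's direct product. Agreement of two pairs is agreement in both coordinates, so
  every clause follows from its counterparts for \<open>f\<close> and \<open>g\<close>.\<close>

lemma idem_MOLS_product:
  assumes f: "idem_MOLS A k f" and g: "idem_MOLS B k g"
  shows "idem_MOLS (A \<times> B) k (\<lambda>j b x. (f j (fst b) (fst x), g j (snd b) (snd x)))"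
  unfolding idem_MOLS_def
proof (intro conjI allI ballI impI)
  show "(f j (fst b) (fst x), g j (snd b) (snd x)) \<in> A \<times> B"
    if "j < k" "b \<in> A \<times> B" "x \<in> A \<times> B" for j b x
    using that idem_MOLS_closed[OF f] idem_MOLS_closed[OF g] by auto
  show "(f j (fst b) (fst b), g j (snd b) (snd b)) = b"
    if "j < k" "b \<in> A \<times> B" for j b
    using that idem_MOLS_idem[OF f] idem_MOLS_idem[OF g] by auto
  show "x = y"
    if "j < k" "b \<in> A \<times> B" "x \<in> A \<times> B" "y \<in> A \<times> B"
      "(f j (fst b) (fst x), g j (snd b) (snd x)) = (f j (fst b) (fst y), g j (snd b) (snd y))"
    for j b x y
    using that idem_MOLS_row[OF f, of j "fst b" "fst x" "fst y"]
      idem_MOLS_row[OF g, of j "snd b" "snd x" "snd y"] by auto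
  show "b = c"
    if "j < k" "b \<in> A \<times> B" "c \<in> A \<times> B" "x \<in> A \<times> B"
      "(f j (fst b) (fst x), g j (snd b) (snd x)) = (f j (fst c) (fst x), g j (snd c) (snd x))"
    for j b c x
    using that idem_MOLS_col[OF f, of j "fst b" "fst x" "fst c"]
      idem_MOLS_col[OF g, of j "snd b" "snd x" "snd c"] by auto
  show "x = y"
    if "i < k" "j < k" "b \<in> A \<times> B" "c \<in> A \<times> B" "x \<in> A \<times> B" "y \<in> A \<times> B" "i \<noteq> j"
      "(f i (fst b) (fst x), g i (snd b) (snd x)) = (f j (fst c) (fst x), g j (snd c) (snd x))"
      "(f i (fst b) (fst y), g i (snd b) (snd y)) = (f j (fst c) (fst y), g j (snd c) (snd y))"
    for i j b c x y
    using that idem_MOLS_orth[OF f, of i "fst b" "fst x" j "fst c" "fst y"]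
      idem_MOLS_orth[OF g, of i "snd b" "snd x" j "snd c" "snd y"] by auto
qed

lemma idem_MOLS_interval:
  assumes "idem_MOLS A k f" "finite A" "card A = n"
  shows "\<exists>g. idem_MOLS {1..n::nat} k g"
proof -
  obtain h where "bij_betw h A {1..n}"
    using finite_same_card_bij[of A "{1..n}"] assms by auto
  from idem_MOLS_transfer[OF this assms(1)] show ?thesis .
qed

lemma idem_MOLS_prod:
  fixes q :: "'i \<Rightarrow> nat"
  assumes "finite S" "\<And>i. i \<in> S \<Longrightarrow> \<exists>g. idem_MOLS {1..q i} k g"
  shows "\<exists>g. idem_MOLS {1..(\<Prod>i\<in>S. q i)} k g"
  using assms
proof (induction S rule: finite_induct)
  case empty
  \<comment> \<open>The empty product is 1, and a one-point set carries any number \<open>k\<close>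
    of squares.\<close>
  have "idem_MOLS {1..1::nat} k (\<lambda>_ _ _. 1)" by (simp add: idem_MOLS_def)
  then show ?case by auto
next
  case (insert a S)
  obtain f where f: "idem_MOLS {1..q a} k f" using insert.prems[OF insertI1] ..
  obtain g where g: "idem_MOLS {1..(\<Prod>i\<in>S. q i)} k g"
    using insert.IH[OF insert.prems[OF insertI2]] ..
  from idem_MOLS_interval[OF idem_MOLS_product[OF f g]] insert.hyps show ?case by simp
qed

section \<open>Permutation codes from Latin squares\<close>

text \<open>The words are the rows of all squares. Row \<open>b\<close> fixes only \<open>b\<close>,
  so each symbol gets one word per square; \<open>n \<ge> 2\<close> keeps these words distinct,
  since they agree in at most one place.\<close>

lemma IPC_of_idem_MOLS:
  assumes f: "idem_MOLS {1..n::nat} k f" and n: "n \<ge> 2"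
  shows "\<exists>C. r_IPC k n C"
proof -
  \<comment> \<open>\<open>permutes\<close> demands the identity outside \<open>{1..n}\<close>,
    where nothing is known about \<open>f\<close>.\<close>
  define s where "s j b x = (if x \<in> {1..n} then f j b x else x)" for j b x
  define C where "C = {s j b |j b. j < k \<and> b \<in> {1..n}}"
  note closed = idem_MOLS_closed[OF f]
  have perm: "s j b permutes {1..n}" if "j < k" "b \<in> {1..n}" for j b
  proof (rule bij_imp_permutes)
    have "inj_on (s j b) {1..n}"
      using idem_MOLS_row[OF f _ that] by (auto simp: s_def simp del: atLeastAtMost_iff intro!: inj_onI)
    moreover have "s j b ` {1..n} \<subseteq> {1..n}"
      using that closed by (auto simp: s_def simp del: atLeastAtMost_iff)
    ultimately show "bij_betw (s j b) {1..n} {1..n}"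
      by (simp add: bij_betw_def endo_inj_surj)
  qed (auto simp: s_def)
  have agree: "card {x \<in> {1..n}. s i b x = s j c x} \<le> 1"
    if "i < k" "j < k" "b \<in> {1..n}" "c \<in> {1..n}" "(i, b) \<noteq> (j, c)" for i j b c
  proof -
    have "x = y" if "x \<in> {1..n}" "y \<in> {1..n}" "s i b x = s j c x" "s i b y = s j c y" for x y
    proof (cases "i = j")
      case True
      then have "f i b x = f i c x" using that by (simp add: s_def)
      then have "b = c" by (rule idem_MOLS_col[OF f]) fact+
      then show ?thesis using True \<open>(i, b) \<noteq> (j, c)\<close> by simp
    next
      case False
      moreover have "f i b x = f j c x" "f i b y = f j c y" using that by (auto simp: s_def)
      ultimately show ?thesis
        using idem_MOLS_orth[OF f] that(1,2) \<open>i < k\<close> \<open>j < k\<close> \<open>b \<in> _\<close> \<open>c \<in> _\<close> by metis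
    qed
    then show ?thesis by (simp add: card_le_Suc0_iff_eq)
  qed
  have fixed: "s j b x = x \<longleftrightarrow> x = b" if "j < k" "b \<in> {1..n}" "x \<in> {1..n}" for j b x
  proof
    \<comment> \<open>By idempotence the symbol \<open>x\<close> also stands in row \<open>x\<close>
      of column \<open>x\<close>, so the column clause forces \<open>x = b\<close>.\<close>
    assume "s j b x = x"
    then have "f j b x = f j x x" using idem_MOLS_idem[OF f] that by (simp add: s_def)
    then show "x = b" using idem_MOLS_col[OF f] that by metis
  qed (use idem_MOLS_idem[OF f] that in \<open>auto simp: s_def\<close>)
  have "permutation_code n (n - 1) C"
    unfolding permutation_code_def
  proof (intro conjI ballI impI)
    show "C \<subseteq> {\<sigma>. \<sigma> permutes {1..n}}" using perm by (auto simp: C_def)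
  next
    fix \<sigma> \<tau> assume "\<sigma> \<in> C" "\<tau> \<in> C" "\<sigma> \<noteq> \<tau>"
    then have "card {x \<in> {1..n}. \<sigma> x = \<tau> x} \<le> 1" unfolding C_def using agree by blast
    moreover have "card {x \<in> {1..n}. \<sigma> x = \<tau> x} + card {x \<in> {1..n}. \<sigma> x \<noteq> \<tau> x} = n"
    proof -
      have "{1..n} = {x \<in> {1..n}. \<sigma> x = \<tau> x} \<union> {x \<in> {1..n}. \<sigma> x \<noteq> \<tau> x}" by auto
      then have "card {1..n} = card \<dots>" by (rule arg_cong)
      also have "\<dots> = card {x \<in> {1..n}. \<sigma> x = \<tau> x} + card {x \<in> {1..n}. \<sigma> x \<noteq> \<tau> x}"
        by (rule card_Un_disjoint) auto
      finally show ?thesis by simp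
    qed
    ultimately show "n - 1 \<le> hamming_dist n \<sigma> \<tau>" by (simp add: hamming_dist_def)
  qed
  moreover have "idempotent_code n C"
    unfolding idempotent_code_def
  proof
    fix \<sigma> assume "\<sigma> \<in> C"
    then obtain j b where "\<sigma> = s j b" "j < k" "b \<in> {1..n}" by (auto simp: C_def)
    then show "\<exists>!x. x \<in> {1..n} \<and> \<sigma> x = x" using fixed by metis
  qed
  moreover have "card {\<sigma> \<in> C. \<sigma> i = i} = k" if i: "i \<in> {1..n}" for i
  proof -
    have "{\<sigma> \<in> C. \<sigma> i = i} = (\<lambda>j. s j i) ` {..<k}"
      using fixed i by (auto simp: C_def simp del: atLeastAtMost_iff)
    moreover have "inj_on (\<lambda>j. s j i) {..<k}"
    proof (rule inj_onI, rule ccontr)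
      fix j l assume *: "j \<in> {..<k}" "l \<in> {..<k}" "s j i = s l i" "j \<noteq> l"
      then have "{x \<in> {1..n}. s j i x = s l i x} = {1..n}" by auto
      then have "card {1..n} \<le> 1" using agree[of j l i i] * i by simp
      then show False using n by simp
    qed
    ultimately show ?thesis by (simp add: card_image)
  qed
  ultimately have "r_IPC k n C" by (simp add: r_IPC_def)
  then show ?thesis ..
qed

section \<open>Ideals\<close>

definition is_ideal :: "'a::comm_ring_1 set \<Rightarrow> bool" where
  "is_ideal I \<longleftrightarrow> 0 \<in> I \<and> (\<forall>x\<in>I. \<forall>y\<in>I. x + y \<in> I) \<and> (\<forall>x\<in>I. \<forall>r. r * x \<in> I)"

lemma ideal_add: "is_ideal I \<Longrightarrow> x \<in> I \<Longrightarrow> y \<in> I \<Longrightarrow> x + y \<in> I"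
  and ideal_mult: "is_ideal I \<Longrightarrow> x \<in> I \<Longrightarrow> r * x \<in> I"
  and ideal_0: "is_ideal I \<Longrightarrow> 0 \<in> I"
  by (auto simp: is_ideal_def)

lemma ideal_mult_right: "is_ideal I \<Longrightarrow> x \<in> I \<Longrightarrow> x * r \<in> I"
  using ideal_mult[of I x r] by (simp add: mult.commute)

lemma ideal_uminus: "is_ideal I \<Longrightarrow> x \<in> I \<Longrightarrow> - x \<in> I"
  using ideal_mult[of I x "-1"] by simp

lemma ideal_diff: "is_ideal I \<Longrightarrow> x \<in> I \<Longrightarrow> y \<in> I \<Longrightarrow> x - y \<in> I"
  using ideal_add[of I x "-y"] ideal_uminus[of I y] by simp

text \<open>Zorn's lemma gives an ideal that is maximal among those containing \<open>I\<close> and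
  avoiding 1; maximality makes it prime.\<close>

lemma exists_prime_ideal:
  fixes I :: "'a::comm_ring_1 set"
  assumes "is_ideal I" "1 \<notin> I"
  shows "\<exists>P. is_ideal P \<and> I \<subseteq> P \<and> 1 \<notin> P \<and> (\<forall>a b. a * b \<in> P \<longrightarrow> a \<in> P \<or> b \<in> P)"
proof -
  define \<A> where "\<A> = {J. is_ideal J \<and> I \<subseteq> J \<and> 1 \<notin> J}"
  have "\<exists>M\<in>\<A>. \<forall>X\<in>\<A>. M \<subseteq> X \<longrightarrow> X = M"
  proof (rule subset_Zorn_nonempty)
    show "\<A> \<noteq> {}" using assms by (auto simp: \<A>_def)
  next
    fix \<C> assume ne: "\<C> \<noteq> {}" and ch: "subset.chain \<A> \<C>"
    have sub: "\<C> \<subseteq> \<A>" and tot: "\<And>X Y. X \<in> \<C> \<Longrightarrow> Y \<in> \<C> \<Longrightarrow> X \<subseteq> Y \<or> Y \<subseteq> X"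
      using ch by (auto simp: subset_chain_def)
    have "is_ideal (\<Union>\<C>)"
      unfolding is_ideal_def
    proof (intro conjI ballI allI)
      show "0 \<in> \<Union>\<C>" using ne sub by (auto simp: \<A>_def is_ideal_def)
    next
      fix x y assume "x \<in> \<Union>\<C>" "y \<in> \<Union>\<C>"
      then obtain X Y where XY: "X \<in> \<C>" "Y \<in> \<C>" "x \<in> X" "y \<in> Y" by blast
      then obtain Z where "Z \<in> \<C>" "x \<in> Z" "y \<in> Z" using tot by blast
      moreover from this have "is_ideal Z" using sub by (auto simp: \<A>_def)
      ultimately show "x + y \<in> \<Union>\<C>" using ideal_add by blast
    next
      fix x r assume "x \<in> \<Union>\<C>"
      then obtain X where "X \<in> \<C>" "x \<in> X" by blast
      moreover from this have "r * x \<in> X" using sub by (auto simp: \<A>_def intro: ideal_mult)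
      ultimately show "r * x \<in> \<Union>\<C>" by blast
    qed
    then show "\<Union>\<C> \<in> \<A>" using ne sub by (auto simp: \<A>_def)
  qed
  then obtain M where "M \<in> \<A>" and max\<A>: "\<forall>X\<in>\<A>. M \<subseteq> X \<longrightarrow> X = M" ..
  then have M: "is_ideal M" "I \<subseteq> M" "1 \<notin> M" by (auto simp: \<A>_def)
  have max: "X = M" if "is_ideal X" "M \<subseteq> X" "1 \<notin> X" for X
    using max\<A>[rule_format, of X] that M(2) by (auto simp: \<A>_def)
  have "b \<in> M" if ab: "a * b \<in> M" and a: "a \<notin> M" for a b
  proof -
    \<comment> \<open>The ideal generated by \<open>M\<close> and \<open>a\<close>. It is strictly
      larger than \<open>M\<close>, so it must contain 1.\<close>
    define J where "J = {x + r * a |x r. x \<in> M}"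
    have "is_ideal J"
      unfolding is_ideal_def
    proof (intro conjI ballI allI)
      have "0 = 0 + 0 * a" by simp
      then show "0 \<in> J" unfolding J_def using ideal_0[OF M(1)] by blast
    next
      fix x y assume "x \<in> J" "y \<in> J"
      then obtain u v r s where "x = u + r * a" "y = v + s * a" "u \<in> M" "v \<in> M"
        by (auto simp: J_def)
      then have "x + y = (u + v) + (r + s) * a" "u + v \<in> M"
        using ideal_add[OF M(1)] by (auto simp: algebra_simps)
      then show "x + y \<in> J" unfolding J_def by blast
    next
      fix x t assume "x \<in> J"
      then obtain u r where "x = u + r * a" "u \<in> M" by (auto simp: J_def)
      then have "t * x = t * u + (t * r) * a" "t * u \<in> M"
        by (simp_all add: ideal_mult[OF M(1)] distrib_left mult.assoc)
      then show "t * x \<in> J" unfolding J_def by blast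
    qed
    moreover have "M \<subseteq> J"
    proof
      fix x assume "x \<in> M"
      moreover have "x = x + 0 * a" by simp
      ultimately show "x \<in> J" unfolding J_def by blast
    qed
    moreover have "a \<in> J"
    proof -
      have "a = 0 + 1 * a" by simp
      then show ?thesis unfolding J_def using ideal_0[OF M(1)] by blast
    qed
    ultimately have "1 \<in> J" using max a by blast
    then obtain u r where u: "1 = u + r * a" "u \<in> M" by (auto simp: J_def)
    have "b = (u + r * a) * b" using u by simp
    also have "\<dots> = u * b + r * (a * b)" by (simp add: algebra_simps)
    finally have "b = u * b + r * (a * b)" .
    moreover have "u * b + r * (a * b) \<in> M"
      by (intro ideal_add ideal_mult ideal_mult_right M(1) u ab)
    ultimately show "b \<in> M" by simp
  qed
  then show ?thesis using M by blast
qed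

section \<open>Frobenius modulo an ideal containing \<open>p\<close>\<close>

text \<open>The inner binomial coefficients are divisible by \<open>p\<close>. The error is kept as
  an explicit multiple of \<open>p\<close>, so that it lies in every ideal containing
  \<open>p\<close>.\<close>

lemma freshmans_dream_prime:
  fixes x y :: "'a::comm_ring_1"
  assumes "prime p"
  shows "\<exists>c. (x + y) ^ p = x ^ p + y ^ p + of_nat p * c"
proof -
  have p0: "p > 0" using assms prime_gt_0_nat by blast
  have "\<exists>c. of_nat (p choose k) * x ^ k * y ^ (p - k) = of_nat p * c" if "k \<in> {0<..<p}" for k
  proof -
    have "p dvd p choose k" using that assms by (intro dvd_choose_prime) auto
    then obtain d where "p choose k = p * d" by (auto elim: dvdE)
    then have "of_nat (p choose k) * x ^ k * y ^ (p - k) = of_nat p * (of_nat d * x ^ k * y ^ (p - k))"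
      by (simp add: mult.assoc)
    then show ?thesis by blast
  qed
  then obtain c where c: "\<And>k. k \<in> {0<..<p} \<Longrightarrow> of_nat (p choose k) * x ^ k * y ^ (p - k) = of_nat p * c k"
    by metis
  have S: "{..p} = insert 0 (insert p {0<..<p})" using p0 by auto
  have "(x + y) ^ p = (\<Sum>k\<le>p. of_nat (p choose k) * x ^ k * y ^ (p - k))" by (rule binomial_ring)
  also have "\<dots> = y ^ p + x ^ p + (\<Sum>k\<in>{0<..<p}. of_nat (p choose k) * x ^ k * y ^ (p - k))"
    unfolding S using p0 by (simp add: add.assoc)
  also have "(\<Sum>k\<in>{0<..<p}. of_nat (p choose k) * x ^ k * y ^ (p - k)) = of_nat p * (\<Sum>k\<in>{0<..<p}. c k)"
    unfolding sum_distrib_left by (rule sum.cong) (use c in auto)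
  finally have "(x + y) ^ p = x ^ p + y ^ p + of_nat p * (\<Sum>k\<in>{0<..<p}. c k)" by (simp add: add_ac)
  then show ?thesis by blast
qed

lemma ideal_power_cong:
  assumes "is_ideal I" "x - y \<in> I"
  shows "x ^ n - y ^ n \<in> I"
proof -
  have "x ^ n - y ^ n = (x - y) * (\<Sum>i<n. y ^ (n - Suc i) * x ^ i)" by (rule power_diff_sumr2)
  then show ?thesis using ideal_mult_right assms by metis
qed

text \<open>The induction raises the congruence for \<open>p ^ e\<close> to the power
  \<open>p\<close> and applies the prime case to the \<open>p ^ e\<close>-th powers.\<close>

lemma freshmans_dream_ideal:
  fixes x y :: "'a::comm_ring_1"
  assumes I: "is_ideal I" and p: "prime p" "of_nat p \<in> I"
  shows "(x + y) ^ (p ^ e) - (x ^ (p ^ e) + y ^ (p ^ e)) \<in> I"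
proof (induction e)
  case 0
  then show ?case using ideal_0[OF I] by simp
next
  case (Suc e)
  let ?u = "x ^ (p ^ e)" and ?v = "y ^ (p ^ e)"
  obtain c where c: "(?u + ?v) ^ p = ?u ^ p + ?v ^ p + of_nat p * c"
    using freshmans_dream_prime[OF p(1)] by blast
  have "((x + y) ^ (p ^ e)) ^ p - (?u + ?v) ^ p \<in> I"
    by (rule ideal_power_cong[OF I Suc])
  then have "((x + y) ^ (p ^ e)) ^ p - (?u + ?v) ^ p + of_nat p * c \<in> I"
    using ideal_add ideal_mult_right I p by blast
  then show ?case unfolding c by (simp add: power_mult[symmetric] mult.commute algebra_simps)
qed

section \<open>Evaluation of integer polynomials\<close>

definition ev :: "complex \<Rightarrow> int poly \<Rightarrow> complex" where
  "ev z f = poly (map_poly of_int f) z"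

lemma ev_0 [simp]: "ev z 0 = 0"
  and ev_pCons [simp]: "ev z (pCons a f) = of_int a + z * ev z f"
  by (simp_all add: ev_def map_poly_pCons)

lemma ev_1 [simp]: "ev z 1 = 1"
  by (simp add: one_pCons)

lemma ev_add [simp]: "ev z (f + g) = ev z f + ev z g"
  by (induction f g rule: poly_induct2) (simp_all add: algebra_simps)

lemma ev_uminus [simp]: "ev z (- f) = - ev z f"
  by (induction f) (simp_all add: algebra_simps)

lemma ev_diff [simp]: "ev z (f - g) = ev z f - ev z g"
  using ev_add[of z f "- g"] by simp

lemma ev_smult [simp]: "ev z (smult a f) = of_int a * ev z f"
  by (induction f) (simp_all add: algebra_simps)

lemma ev_mult [simp]: "ev z (f * g) = ev z f * ev z g"
  by (induction f) (simp_all add: algebra_simps)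

lemma ev_power [simp]: "ev z (f ^ n) = ev z f ^ n"
  by (induction n) simp_all

lemma ev_prod [simp]: "ev z (\<Prod>i\<in>A. f i) = (\<Prod>i\<in>A. ev z (f i))"
  by (induction A rule: infinite_finite_induct) simp_all

lemma ev_sum [simp]: "ev z (\<Sum>i\<in>A. f i) = (\<Sum>i\<in>A. ev z (f i))"
  by (induction A rule: infinite_finite_induct) simp_all

lemma ev_of_nat [simp]: "ev z (of_nat n) = of_nat n"
  by (simp add: of_nat_poly)

text \<open>A \<open>\<rat>\<close>-linear retraction of the complex numbers onto the rationals: the
  independent set \<open>{1}\<close> extends to a basis. It serves to measure denominators in
  \<open>\<int>[z]\<close>.\<close>

lemma exists_rational_functional:
  "\<exists>\<phi>::complex \<Rightarrow> rat. (\<forall>x y. \<phi> (x + y) = \<phi> x + \<phi> y) \<and> (\<forall>r x. \<phi> (of_rat r * x) = r * \<phi> x) \<and> \<phi> 1 = 1"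
proof -
  interpret vector_space_pair "\<lambda>(r::rat) (z::complex). of_rat r * z" "\<lambda>(r::rat) (s::rat). r * s"
    by unfold_locales (auto simp: algebra_simps of_rat_add of_rat_mult)
  have "vs1.independent {1}" by simp
  from linear_independent_extend[OF this, of "\<lambda>_. 1"] obtain \<phi>
    where \<phi>: "Vector_Spaces.linear (\<lambda>(r::rat) (z::complex). of_rat r * z) (\<lambda>(r::rat) (s::rat). r * s) \<phi>" "\<phi> 1 = 1"
    by auto
  from \<phi>(1) have "\<phi> (x + y) = \<phi> x + \<phi> y" "\<phi> (of_rat r * x) = r * \<phi> x" for x y r
    unfolding Vector_Spaces.linear_iff by auto
  then show ?thesis using \<phi>(2) by (intro exI[of _ \<phi>]) simp
qed

text \<open>
  A rational functional fixing 1 takes values with bounded denominators on \<open>\<int>[z]\<close>, whereas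
  inverting \<open>p\<close> would put all the \<open>1 / p ^ k\<close> there.
\<close>

lemma root_of_unity_prime_not_unit:
  assumes z: "z ^ m = 1" and m: "m > 0" and p: "p > 1"
  shows "of_nat p * ev z f \<noteq> 1"
proof
  assume f: "of_nat p * ev z f = 1"
  obtain \<phi> :: "complex \<Rightarrow> rat" where add: "\<And>x y. \<phi> (x + y) = \<phi> x + \<phi> y"
    and scale: "\<And>r x. \<phi> (of_rat r * x) = r * \<phi> x" and one: "\<phi> 1 = 1"
    using exists_rational_functional by blast
  have zero: "\<phi> 0 = 0" using add[of 0 0] by simp
  have int: "\<phi> (of_int a * x) = of_int a * \<phi> x" for a x
    using scale[of "of_int a" x] by simp
  define d where "d r = snd (quotient_of r)" for r
  \<comment> \<open>A common denominator of the values of \<open>\<phi>\<close> at all powers of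
    \<open>z\<close>, since exponents matter only modulo \<open>m\<close>.\<close>
  define D where "D = (\<Prod>k<m. d (\<phi> (z ^ k)))"
  have d: "d r > 0" "of_int (d r) * r \<in> \<int>" for r
  proof -
    obtain a b where ab: "quotient_of r = (a, b)" by (cases "quotient_of r")
    show "d r > 0" by (simp add: d_def quotient_of_denom_pos')
    then have "of_int (d r) * r = of_int a"
      using quotient_of_div[OF ab] ab by (simp add: d_def)
    then show "of_int (d r) * r \<in> \<int>" by simp
  qed
  have D: "D > 0" unfolding D_def by (intro prod_pos) (use d in auto)
  have pow: "of_int D * \<phi> (z ^ j) \<in> \<int>" for j
  proof -
    have "z ^ j = z ^ (j mod m + m * (j div m))" by simp
    also have "\<dots> = z ^ (j mod m)" unfolding power_add power_mult z by simp
    finally have zj: "z ^ j = z ^ (j mod m)" .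
    have "D = (\<Prod>k\<in>{..<m} - {j mod m}. d (\<phi> (z ^ k))) * d (\<phi> (z ^ j))"
      unfolding D_def zj using m by (subst prod.remove[of _ "j mod m"]) auto
    then have "of_int D * \<phi> (z ^ j) =
        of_int (\<Prod>k\<in>{..<m} - {j mod m}. d (\<phi> (z ^ k))) * (of_int (d (\<phi> (z ^ j))) * \<phi> (z ^ j))"
      by (simp add: mult_ac)
    then show ?thesis using d(2) by (metis Ints_mult Ints_of_int)
  qed
  \<comment> \<open>The factor \<open>z ^ j\<close> carries the induction: splitting off a
    coefficient of the polynomial raises \<open>j\<close> by one.\<close>
  have ints: "of_int D * \<phi> (z ^ j * ev z g) \<in> \<int>" for j g
  proof (induction g arbitrary: j)
    case 0
    then show ?case by (simp add: zero)
  next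
    case (pCons a g)
    have "z ^ j * ev z (pCons a g) = of_int a * z ^ j + z ^ Suc j * ev z g"
      by (simp add: algebra_simps)
    then have "of_int D * \<phi> (z ^ j * ev z (pCons a g)) =
       of_int a * (of_int D * \<phi> (z ^ j)) + of_int D * \<phi> (z ^ Suc j * ev z g)"
      by (simp only: add int) (simp add: algebra_simps)
    then show ?case using pow[of j] pCons.IH[of "Suc j"] by (simp del: ev_pCons power_Suc)
  qed
  \<comment> \<open>The assumption \<open>f\<close> puts \<open>1 / p ^ k = ev z (f ^ k)\<close>
    into \<open>\<int>[z]\<close>. As \<open>\<phi>\<close> fixes 1, \<open>D / p ^ k\<close> is an
    integer.\<close>
  have dvd: "int p ^ k dvd D" for k
  proof -
    have "of_int (int p ^ k) * ev z (f ^ k) = 1"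
      using f by (simp add: power_mult_distrib[symmetric])
    then have "of_int (int p ^ k) * \<phi> (ev z (f ^ k)) = 1"
      using int one by metis
    then have "of_int D = of_int (int p ^ k) * (of_int D * \<phi> (ev z (f ^ k)))"
      by (simp add: mult_ac)
    moreover obtain c where "of_int D * \<phi> (ev z (f ^ k)) = of_int c"
      using ints[of 0 "f ^ k"] by (auto elim: Ints_cases)
    ultimately have "(of_int D :: rat) = of_int (int p ^ k * c)" by (simp only: of_int_mult)
    then have "D = int p ^ k * c" unfolding of_int_eq_iff .
    then show ?thesis by simp
  qed
  have "int p ^ nat D \<le> D" using zdvd_imp_le dvd D by blast
  moreover have "D < int p ^ nat D"
  proof -
    have "nat D < p ^ nat D" using p by (simp add: power_gt_expt)
    then show ?thesis using D by (metis of_nat_power nat_less_iff less_imp_le)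
  qed
  ultimately show False by simp
qed

text \<open>Injectivity makes \<open>z\<close> a primitive \<open>m\<close>-th root of unity. As
  polynomials in \<open>x\<close>, both sides are monic of degree \<open>m\<close> and vanish at the
  same \<open>m\<close> points.\<close>

lemma prod_roots_unity:
  assumes m: "m > 0" and inj: "inj_on (\<lambda>k. z ^ k) {..<m}" and z: "z ^ m = (1::complex)"
  shows "(\<Prod>k<m. (x - z ^ k)) = x ^ m - 1"
proof -
  define P Q where "P = (\<Prod>k<m. [:- (z ^ k), 1:])" and "Q = monom 1 m - (1 :: complex poly)"
  have dQ: "degree Q = m"
    unfolding Q_def using m by (subst diff_conv_add_uminus, subst degree_add_eq_left)
      (auto simp: degree_monom_eq)
  have dP: "degree P = m" "lead_coeff P = 1" unfolding P_def
    by (subst degree_prod_sum_eq) (auto simp: lead_coeff_prod)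
  have lQ: "coeff Q m = 1" using m by (simp add: Q_def)
  have "P = Q"
  proof (rule poly_eqI_degree_lead_coeff[where n = m and A = "(\<lambda>k. z ^ k) ` {..<m}"])
    show "card ((\<lambda>k. z ^ k) ` {..<m}) \<ge> m" using inj by (simp add: card_image)
    fix w assume "w \<in> (\<lambda>k. z ^ k) ` {..<m}"
    then obtain k where k: "k < m" "w = z ^ k" by auto
    then have "poly P w = 0" by (auto simp: P_def poly_prod)
    moreover have "w ^ m = 1" using k z by (metis power_mult mult.commute power_one)
    ultimately show "poly P w = poly Q w" by (simp add: Q_def poly_monom)
  qed (use dP dQ lQ in auto)
  then have "poly P x = poly Q x" by simp
  then show ?thesis by (simp add: P_def Q_def poly_prod poly_monom)
qed

section \<open>Prime powers\<close>

text \<open>No quotient ring is formed: residue classes modulo \<open>P\<close> are handled through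
  the transversal \<open>A\<close>, and entries are computed with polynomials and then reduced to
  \<open>A\<close>.\<close>

lemma idem_MOLS_prime_power:
  assumes p: "prime p" and e: "e \<ge> 1"
  shows "\<exists>g. idem_MOLS {1..p ^ e} (p ^ e - 2) g"
proof -
  define m where "m = p ^ e - 1"
  have p1: "p > 1" using p prime_gt_1_nat by blast
  have q: "p ^ e > 1" using p1 e by (intro one_less_power) auto
  then have m: "m > 0" "p ^ e = Suc m" by (auto simp: m_def)
  define z where "z = cis (2 * pi / m)"
  have zk: "z ^ k = cis (2 * pi * real k / real m)" for k
    unfolding z_def DeMoivre by (simp add: mult_ac)
  have inj: "inj_on (\<lambda>k. z ^ k) {..<m}" unfolding zk
    using bij_betw_roots_unity[OF m(1)] by (simp add: bij_betw_def)
  have z: "z ^ m = 1" using zk[of m] m by simp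
  \<comment> \<open>\<open>\<int>[z]\<close> is replaced by \<^typ>\<open>int poly\<close>, with the kernel of \<^term>\<open>ev z\<close> put into the ideal.\<close>
  define I where "I = {of_nat p * f + g |f g. ev z g = 0}"
  have ker: "g \<in> I" if "ev z g = 0" for g
  proof -
    have "g = of_nat p * 0 + g" by simp
    then show ?thesis unfolding I_def using that by blast
  qed
  have pI: "of_nat p \<in> I"
  proof -
    have "of_nat p = of_nat p * 1 + (0 :: int poly)" by simp
    then show ?thesis unfolding I_def using ev_0 by blast
  qed
  have "is_ideal I"
    unfolding is_ideal_def
  proof (intro conjI ballI allI)
    show "0 \<in> I" by (rule ker) simp
  next
    fix x y assume "x \<in> I" "y \<in> I"
    then obtain f g f' g' where "x = of_nat p * f + g" "y = of_nat p * f' + g'" "ev z g = 0" "ev z g' = 0"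
      by (auto simp: I_def)
    then have "x + y = of_nat p * (f + f') + (g + g')" "ev z (g + g') = 0" by (auto simp: algebra_simps)
    then show "x + y \<in> I" unfolding I_def by blast
  next
    fix x r assume "x \<in> I"
    then obtain f g where "x = of_nat p * f + g" "ev z g = 0" by (auto simp: I_def)
    then have "r * x = of_nat p * (r * f) + r * g" "ev z (r * g) = 0" by (auto simp: algebra_simps)
    then show "r * x \<in> I" unfolding I_def by blast
  qed
  moreover have "1 \<notin> I"
  proof
    assume "1 \<in> I"
    then obtain f g where "1 = of_nat p * f + g" "ev z g = 0" by (auto simp: I_def)
    then have "of_nat p * ev z f = 1" using ev_add[of z "of_nat p * f" g] by simp
    then show False using root_of_unity_prime_not_unit[OF z m(1) p1] by blast
  qed
  ultimately obtain P where P: "is_ideal P" "I \<subseteq> P" "1 \<notin> P"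
    and prime: "\<And>a b. a * b \<in> P \<Longrightarrow> a \<in> P \<or> b \<in> P"
    using exists_prime_ideal by metis
  note add = ideal_add[OF P(1)] and mult = ideal_mult[OF P(1)] and diff = ideal_diff[OF P(1)]
  have pP: "of_nat p \<in> P" and kerP: "\<And>g. ev z g = 0 \<Longrightarrow> g \<in> P" using pI ker P(2) by auto
  define X :: "int poly" where "X = [:0, 1:]"
  have evX [simp]: "ev z X = z" by (simp add: X_def)

  \<comment> \<open>The polynomials fixed modulo \<open>P\<close> by the power map. They are closed
    under sums and products and contain \<open>X\<close> and the constants, so they are all
    polynomials.\<close>
  define S where "S = {f. f ^ (p ^ e) - f \<in> P}"
  note dream = freshmans_dream_ideal[OF P(1) p pP, of _ _ e]
  have Sadd: "x + y \<in> S" if "x \<in> S" "y \<in> S" for x y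
    using add[OF dream[of x y] add[of "x ^ (p ^ e) - x" "y ^ (p ^ e) - y"]] that
    by (simp add: S_def algebra_simps)
  have Smult: "x * y \<in> S" if "x \<in> S" "y \<in> S" for x y
  proof -
    have "y ^ (p ^ e) * (x ^ (p ^ e) - x) + x * (y ^ (p ^ e) - y) \<in> P"
      using that by (intro add mult) (auto simp: S_def)
    then show ?thesis by (simp add: S_def algebra_simps)
  qed
  \<comment> \<open>Writing \<open>x\<close> as \<open>(x - 1) + 1\<close> avoids the sign of
    \<open>(-1) ^ (p ^ e)\<close>. This step reaches the negative constants.\<close>
  have Sdiff1: "x - 1 \<in> S" if "x \<in> S" for x
    using diff[of "x ^ (p ^ e) - x", OF _ dream[of "x - 1" 1]] that
    by (simp add: S_def algebra_simps)
  have S1: "1 \<in> S" and S0: "0 \<in> S" using q ideal_0[OF P(1)] by (auto simp: S_def power_0_left)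
  have SX: "X \<in> S"
    unfolding S_def by (auto intro!: kerP simp: m(2) z)
  have Sconst: "[:a:] \<in> S" for a
  proof -
    have "of_int a \<in> S"
      by (induction a rule: int_induct[of _ 0]) (use S0 Sadd S1 Sdiff1 in auto)
    then show ?thesis by (simp add: of_int_poly)
  qed
  have S: "f \<in> S" for f
  proof (induction f)
    case 0
    then show ?case using S0 by simp
  next
    case (pCons a f)
    have "pCons a f = [:a:] + X * f" by (simp add: X_def)
    then show ?case using pCons Sadd Smult SX Sconst by metis
  qed

  define A where "A = insert 0 ((\<lambda>k. X ^ k) ` {..<m})"
  have rep: "\<exists>a\<in>A. f - a \<in> P" for f
  proof -
    \<comment> \<open>Up to the kernel of \<open>ev z\<close>, \<open>f ^ (p ^ e) - f\<close> is the
      product of the \<open>f - a\<close> for \<open>a\<close> in \<open>A\<close>. Since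
      \<open>P\<close> is prime, one factor lies in \<open>P\<close>.\<close>
    have "f ^ (p ^ e) - f - f * (\<Prod>k<m. (f - X ^ k)) \<in> P"
      by (rule kerP) (simp add: m(2) prod_roots_unity[OF m(1) inj z] algebra_simps)
    from diff[OF _ this, of "f ^ (p ^ e) - f"] S[of f]
    have "f * (\<Prod>k<m. (f - X ^ k)) \<in> P" by (simp add: S_def)
    then consider "f \<in> P" | "(\<Prod>k<m. (f - X ^ k)) \<in> P" using prime by blast
    then show ?thesis
    proof cases
      case 1
      then show ?thesis by (simp add: A_def)
    next
      case 2
      have "\<exists>k\<in>B. f - X ^ k \<in> P" if "finite B" "(\<Prod>k\<in>B. (f - X ^ k)) \<in> P" for B
        using that by (induction B rule: finite_induct) (use prime P(3) in auto)
      from this[OF _ 2] show ?thesis by (auto simp: A_def)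
    qed
  qed
  \<comment> \<open>\<open>X\<close> is invertible modulo \<open>P\<close> because
    \<open>X ^ m\<close> is 1 there, so the proper ideal \<open>P\<close> contains none of its
    powers.\<close>
  have X0: "X ^ k \<notin> P" for k
  proof
    assume "X ^ k \<in> P"
    then have "X ^ (k * (m - 1)) * X ^ k \<in> P" by (rule mult)
    moreover have "X ^ (k * (m - 1)) * X ^ k = (X ^ m) ^ k"
      using m(1) by (simp flip: power_add power_mult add: algebra_simps)
    moreover have "(X ^ m) ^ k - 1 \<in> P" by (rule kerP) (simp add: z)
    ultimately show False using diff[of "(X ^ m) ^ k" "(X ^ m) ^ k - 1"] P(3) by simp
  qed
  \<comment> \<open>If \<open>X ^ d = 1\<close> modulo \<open>P\<close>, then the vanishing sum of the \<open>z ^ (d * i)\<close> is \<open>m = -1\<close> modulo \<open>P\<close>.\<close>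
  have X1: "X ^ d - 1 \<notin> P" if "0 < d" "d < m" for d
  proof
    assume d: "X ^ d - 1 \<in> P"
    have zd: "z ^ d \<noteq> 1" using inj_onD[OF inj, of d 0] that by auto
    have "(z ^ d) ^ m = (z ^ m) ^ d" by (simp add: mult.commute flip: power_mult)
    then have "(\<Sum>i<m. (z ^ d) ^ i) = 0" using geometric_sum[OF zd, of m] z by simp
    then have s: "(\<Sum>i<m. (X ^ d) ^ i) \<in> P" by (intro kerP) simp
    have "(\<Sum>i<n. (X ^ d) ^ i) - of_nat n \<in> P" for n
    proof (induction n)
      case 0
      then show ?case using ideal_0[OF P(1)] by simp
    next
      case (Suc n)
      have "(X ^ d) ^ n - 1 ^ n \<in> P" by (rule ideal_power_cong[OF P(1) d])
      from add[OF Suc this] show ?case by (simp add: algebra_simps)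
    qed
    from diff[OF s this[of m]] have mP: "of_nat m \<in> P" by simp
    have "of_nat p ^ e \<in> P" using pP e mult[of "of_nat p" "of_nat p ^ (e - 1)"]
      by (cases e) (auto simp: mult.commute)
    moreover have "(of_nat p ^ e :: int poly) = 1 + of_nat m"
      by (metis m(2) of_nat_Suc of_nat_power)
    ultimately have "1 + of_nat m \<in> P" by simp
    from diff[OF this mP] P(3) show False by simp
  qed
  have Xij: "X ^ i - X ^ j \<notin> P" if "i \<noteq> j" "i < m" "j < m" for i j
  proof -
    have *: "X ^ j - X ^ i \<notin> P" if "i < j" "j < m" for i j
    proof -
      have "X ^ j - X ^ i = X ^ i * (X ^ (j - i) - 1)"
        using that by (simp add: algebra_simps flip: power_add)
      then show ?thesis using prime[of "X ^ i" "X ^ (j - i) - 1"] X0 X1[of "j - i"] that by auto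
    qed
    show ?thesis
    proof (cases "i < j")
      case True
      then show ?thesis using *[of i j] ideal_uminus[OF P(1), of "X ^ i - X ^ j"] that by auto
    next
      case False
      then show ?thesis using *[of j i] that by auto
    qed
  qed
  have uniq: "a = b" if "a \<in> A" "b \<in> A" "a - b \<in> P" for a b
  proof -
    have ba: "b - a \<in> P" using ideal_uminus[OF P(1) \<open>a - b \<in> P\<close>] by simp
    from \<open>a \<in> A\<close> consider "a = 0" | i where "i < m" "a = X ^ i" unfolding A_def by blast
    then show ?thesis
    proof cases
      case 1
      from \<open>b \<in> A\<close> show ?thesis using 1 ba X0 by (auto simp only: A_def diff_0_right)
    next
      case (2 i)
      from \<open>b \<in> A\<close> consider "b = 0" | j where "j < m" "b = X ^ j" unfolding A_def by blast
      then show ?thesis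
      proof cases
        case 1
        then show ?thesis using \<open>a - b \<in> P\<close> 2 X0 by simp
      next
        case (2 j)
        then show ?thesis using Xij[of i j] \<open>a - b \<in> P\<close> \<open>i < m\<close> \<open>a = X ^ i\<close> by (cases "i = j") simp_all
      qed
    qed
  qed
  have cardA: "card A = p ^ e"
  proof -
    have "inj_on (\<lambda>k. X ^ k) {..<m}"
      using Xij ideal_0[OF P(1)] by (force simp: inj_on_def)
    moreover have "0 \<notin> (\<lambda>k. X ^ k) ` {..<m}" by (auto simp: X_def)
    ultimately show ?thesis using m by (simp add: A_def card_image)
  qed

  \<comment> \<open>Reduction to the representative in \<open>A\<close>: it exists by
    \<open>rep\<close> and is the only one by \<open>uniq\<close>.\<close>
  define r where "r f = (SOME a. a \<in> A \<and> f - a \<in> P)" for f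
  have r: "r f \<in> A" "f - r f \<in> P" for f
    using someI_ex[of "\<lambda>a. a \<in> A \<and> f - a \<in> P"] rep[of f] by (auto simp: r_def)
  have req: "f - g \<in> P" if "r f = r g" for f g
    using diff[OF r(2)[of f] r(2)[of g]] that by simp
  \<comment> \<open>The multiplier is \<open>X ^ Suc j\<close>: for \<open>j < p ^ e - 2\<close> the
    exponent runs through \<open>1, ..., m - 1\<close>, which gives exactly the elements of
    \<open>A\<close> other than 0 and 1.\<close>
  define F where "F j b x = r (X ^ Suc j * (x - b) + b)" for j :: nat and b x
  have "idem_MOLS A (p ^ e - 2) F"
    unfolding idem_MOLS_def
  proof (intro conjI allI ballI impI)
    show "F j b x \<in> A" for j b x by (simp add: F_def r)
  next
    fix j b assume "b \<in> A"
    then show "F j b b = b" using uniq[of b "r b"] r[of b] by (simp add: F_def)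
  next
    fix j b x y assume "x \<in> A" "y \<in> A" "F j b x = F j b y"
    then have "X ^ Suc j * (x - y) \<in> P"
      using req[of "X ^ Suc j * (x - b) + b" "X ^ Suc j * (y - b) + b"]
      by (simp add: F_def algebra_simps)
    then show "x = y" using prime X0 uniq \<open>x \<in> A\<close> \<open>y \<in> A\<close> by blast
  next
    fix j b c x assume j: "j < p ^ e - 2" and bc: "b \<in> A" "c \<in> A" and eq: "F j b x = F j c x"
    \<comment> \<open>\<open>X ^ 0\<close> stands for 1 so that \<open>Xij\<close> applies: the
      multiplier is not 1 modulo \<open>P\<close>.\<close>
    have "(X ^ Suc j - X ^ 0) * (c - b) \<in> P" using req[OF eq[unfolded F_def]] by (simp add: algebra_simps)
    moreover have "X ^ Suc j - X ^ 0 \<notin> P" using j m by (intro Xij) auto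
    ultimately show "b = c" using prime uniq bc by blast
  next
    fix i j b c x y
    assume ij: "i < p ^ e - 2" "j < p ^ e - 2" "i \<noteq> j" and xy: "x \<in> A" "y \<in> A"
      and eq: "F i b x = F j c x" "F i b y = F j c y"
    \<comment> \<open>Subtracting the congruence at \<open>y\<close> from the one at
      \<open>x\<close> removes \<open>b\<close> and \<open>c\<close>.\<close>
    have "(X ^ Suc i - X ^ Suc j) * (x - y) \<in> P"
      using diff[OF req[OF eq(1)[unfolded F_def]] req[OF eq(2)[unfolded F_def]]]
      by (simp add: algebra_simps)
    moreover have "X ^ Suc i - X ^ Suc j \<notin> P" using ij m by (intro Xij) auto
    ultimately show "x = y" using prime uniq xy by blast
  qed
  then show ?thesis by (rule idem_MOLS_interval) (simp_all add: cardA, simp add: A_def)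
qed

text \<open>Each factor \<open>p i ^ e i\<close> has at least \<open>q - 2\<close> squares. Cutting
  every system down to \<open>q - 2\<close> lets them be multiplied, and the rows of the product
  form the code. For \<open>q = 2\<close> there are no squares and the code is empty.\<close>

theorem theorem2p6:
  fixes n t q :: nat and p e :: "nat \<Rightarrow> nat"
  assumes "n \<ge> 2"
    and "\<And>i. i \<in> {1..t} \<Longrightarrow> prime (p i)"
    and "inj_on p {1..t}"
    and "\<And>i. i \<in> {1..t} \<Longrightarrow> e i \<ge> 1"
    and "n = (\<Prod>i\<in>{1..t}. p i ^ e i)"
    and "q = Min ((\<lambda>i. p i ^ e i) ` {1..t})"
  shows "\<exists>C. r_IPC (q - 2) n C"
proof -
  have "\<exists>g. idem_MOLS {1..p i ^ e i} (q - 2) g" if i: "i \<in> {1..t}" for i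
  proof -
    have "q \<le> p i ^ e i" unfolding assms(6) using i by (intro Min_le) auto
    then have "q - 2 \<le> p i ^ e i - 2" by simp
    moreover obtain g where "idem_MOLS {1..p i ^ e i} (p i ^ e i - 2) g"
      using idem_MOLS_prime_power[OF assms(2,4)[OF i]] ..
    ultimately show ?thesis using idem_MOLS_mono by metis
  qed
  then have "\<exists>g. idem_MOLS {1..n} (q - 2) g" unfolding assms(5)
    by (intro idem_MOLS_prod) auto
  then obtain g where "idem_MOLS {1..n} (q - 2) g" ..
  from IPC_of_idem_MOLS[OF this assms(1)] show ?thesis .
qed

end
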